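(* (1) Let $p_1,\dots,p_6$ be distinct primes with $p_i\le 19$ for $i=1,\dots,6$. Then every solution in non-negative integers $\alpha_1,\dots,\alpha_6$ of $$p_1^{\alpha_1}p_2^{\alpha_2}+p_3^{\alpha_3}p_4^{\alpha_4}-p_5^{\alpha_5}p_6^{\alpha_6}=1$$ satisfies $\min_{1\le i\le 6}\alpha_i\le 5$. (2) The equation $$2^{\alpha_1}3^{\alpha_2}+5^{\alpha_3}7^{\alpha_4}-11^{\alpha_5}13^{\alpha_6}=1$$ has exactly two solutions in non-negative integers $\alpha_1,\dots,\alpha_6$, namely $(\alpha_1,\dots,\alpha_6)=(0,0,0,0,0,0)$ and $(0,2,1,0,0,1)$. *)

theory Defs
  imports "HOL-Computational_Algebra.Primes"
begin

end

theory Submission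
  imports Defs "HOL-Number_Theory.Mod_Exp"
begin

text \<open>
  Parity excludes the prime 2, which leaves finitely many equations \<open>X + Y = Z + 1\<close> whose terms are
  products of powers of odd primes.  Each is refuted by reducing it modulo a list of prime powers \<open>q\<close>
  in turn.  A term divisible by \<open>q\<close> vanishes (this is where the lower bounds on the exponents
  enter); the residue of any other term \<open>c p\<^sup>a p'\<^sup>b\<close> is determined by its discrete logarithm, a linear
  form in \<open>(a, b)\<close>.  The pairs \<open>(a, b)\<close> that agree modulo all \<open>q\<close> treated so far form a coset of a
  lattice, so the possible residues are the nodes of a tree whose branches at \<open>q\<close> are the cosets of the
  next lattice in the current one.  A sieve runs through the three trees in parallel and keeps the
  triples with \<open>X + Y = Z + 1\<close> modulo \<open>q\<close>; in the end none survives.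

  Moduli prime to all terms cannot suffice: they do not tell large exponents from those of
  \<open>1 + 1 = 1 + 1\<close> or of sporadic solutions such as \<open>5\<^sup>2 \<cdot> 17 + 11 \<cdot> 13 = 3\<^sup>4 \<cdot> 7 + 1\<close>.  The latter are the
  reason for including higher powers of the primes in question.
\<close>

section \<open>Discrete logarithms\<close>

text \<open>
  An entry \<open>(q, n, g)\<close> records a primitive root \<open>g\<close> modulo \<open>q\<close> and its order \<open>n\<close>.  The selection of
  moduli and their order, which is the order of the sieve, come from a computer search that
  kept the sieve small.
\<close>

definition unit_groups :: "(int \<times> int \<times> int) list" where
  "unit_groups =
    [(3, 2, 2), (4, 2, 3), (5, 4, 2), (7, 6, 3), (13, 12, 2), (9, 6, 2), (19, 18, 2), (37, 36, 2),
     (27, 18, 2), (73, 72, 5), (109, 108, 6), (81, 54, 2), (17, 16, 3), (181, 180, 2), (31, 30, 3),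
     (25, 20, 2), (271, 270, 6), (331, 330, 3), (121, 110, 2), (67, 66, 2), (23, 22, 5)]"

definition group_order :: "int \<Rightarrow> int" where
  "group_order q = fst (the (map_of unit_groups q))"

definition primitive_root :: "int \<Rightarrow> int" where
  "primitive_root q = snd (the (map_of unit_groups q))"

definition has_generator :: "int \<Rightarrow> bool" where
  "has_generator q \<longleftrightarrow> 1 < q \<and> 0 < group_order q \<and> mod_exp (primitive_root q) (nat (group_order q)) q = 1"

definition antilog :: "int \<Rightarrow> int \<Rightarrow> int" where
  "antilog q k = primitive_root q ^ nat (k mod group_order q) mod q"

lemma antilog_cong: "[k = l] (mod group_order q) \<Longrightarrow> antilog q k = antilog q l"
  by (simp add: antilog_def cong_def)

lemma power_mod_eq_antilog:
  assumes "has_generator q"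
  shows "primitive_root q ^ n mod q = antilog q (int n)"
proof -
  define m where "m = nat (group_order q)"
  have "primitive_root q ^ n = (primitive_root q ^ m) ^ (n div m) * primitive_root q ^ (n mod m)"
    by (simp flip: power_mult power_add)
  then have "primitive_root q ^ n mod q = 1 ^ (n div m) * primitive_root q ^ (n mod m) mod q"
    using assms by (metis has_generator_def m_def mod_exp_def mod_mult_left_eq power_mod power_one)
  moreover have "nat (int n mod group_order q) = n mod m"
    using assms by (simp add: has_generator_def m_def nat_mod_distrib)
  ultimately show ?thesis
    by (simp add: antilog_def)
qed

lemma antilog_add:
  assumes "has_generator q"
  shows "antilog q (k + l) = antilog q k * antilog q l mod q"
proof -
  let ?k = "k mod group_order q" and ?l = "l mod group_order q"
  have "antilog q k * antilog q l mod q = primitive_root q ^ (nat ?k + nat ?l) mod q"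
    by (simp add: antilog_def power_add mod_simps)
  also have "\<dots> = antilog q (?k + ?l)"
    using assms by (simp add: power_mod_eq_antilog has_generator_def)
  also have "\<dots> = antilog q (k + l)"
    by (rule antilog_cong) (simp add: cong_def mod_simps)
  finally show ?thesis
    by simp
qed

lemma antilog_of_nat_mult:
  assumes "has_generator q"
  shows "antilog q (int n * k) = antilog q k ^ n mod q"
proof (induction n)
  case 0
  then show ?case
    using assms by (simp add: antilog_def)
next
  case (Suc n)
  have "antilog q (int (Suc n) * k) = antilog q k * antilog q (int n * k) mod q"
    by (simp add: antilog_add[OF assms, symmetric] algebra_simps)
  also have "\<dots> = antilog q k ^ Suc n mod q"
    by (simp add: Suc mod_simps)
  finally show ?case .
qed

function tabulates :: "int \<Rightarrow> int \<Rightarrow> int \<Rightarrow> bool" where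
  "tabulates q k x \<longleftrightarrow>
     (k < group_order q \<longrightarrow> antilog q k = x \<and> tabulates q (k + 1) (x * primitive_root q mod q))"
  by auto
termination
  by (relation "measure (\<lambda>(q, k, x). nat (group_order q - k))") auto

declare tabulates.simps [simp del]

lemma tabulates_antilog: "has_generator q \<Longrightarrow> x = antilog q k \<Longrightarrow> tabulates q k x"
proof (induction q k x rule: tabulates.induct)
  case (1 q k x)
  have "antilog q (k + 1) = x * primitive_root q mod q"
    using "1.prems" power_mod_eq_antilog[of q 1, symmetric] by (simp add: antilog_add mod_simps)
  with 1 show ?case
    by (simp add: tabulates.simps[of q k])
qed

function dlog_from :: "int \<Rightarrow> int \<Rightarrow> int \<Rightarrow> int" where
  "dlog_from q x k = (if antilog q k = x \<or> group_order q \<le> k then k else dlog_from q x (k + 1))"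
  by auto
termination
  by (relation "measure (\<lambda>(q, x, k). nat (group_order q - k))") auto

declare dlog_from.simps [simp del]

definition dlog :: "int \<Rightarrow> int \<Rightarrow> int" where
  "dlog q x = dlog_from q (x mod q) 0"

definition has_dlog :: "int \<Rightarrow> int \<Rightarrow> bool" where
  "has_dlog q x \<longleftrightarrow> antilog q (dlog q x) = x mod q"

lemma antilog_dlog_term:
  assumes "has_generator q" "has_dlog q c" "has_dlog q p" "has_dlog q p'"
  shows "antilog q (dlog q c + int a * dlog q p + int b * dlog q p') = c * p ^ a * p' ^ b mod q"
  using assms by (simp add: antilog_add antilog_of_nat_mult has_dlog_def mod_simps)

lemma unit_groups_generated: "list_all (has_generator \<circ> fst) unit_groups"
  by (simp add: has_generator_def group_order_def primitive_root_def unit_groups_def)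

lemmas has_generator_simps = unit_groups_generated[unfolded unit_groups_def, simplified]

section \<open>Vectors of logarithms\<close>

text \<open>
  For \<open>0 \<le> k < 2 n\<close> this is \<open>k mod n\<close>, but cheaper to evaluate by rewriting; a conditional would have
  both of its branches normalised.
\<close>

fun wrap_if :: "bool \<Rightarrow> int \<Rightarrow> int \<Rightarrow> int" where
  "wrap_if True n k = k"
| "wrap_if False n k = k - n"

definition wrap :: "int \<Rightarrow> int \<Rightarrow> int" where
  "wrap n k = wrap_if (k < n) n k"

lemma wrap_cong [simp]: "[wrap n k = k] (mod n)"
  by (cases "k < n") (simp_all add: wrap_def cong_def)

lemma wrap_eq_mod: "0 \<le> k \<Longrightarrow> k < 2 * n \<Longrightarrow> wrap n k = k mod n"
  using mod_pos_pos_trivial[of "k - n" n] by (cases "k < n") (simp_all add: wrap_def)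

fun add_logs :: "int list \<Rightarrow> int list \<Rightarrow> int list \<Rightarrow> int list" where
  "add_logs (q # qs) (k # ks) (l # ls) = wrap (group_order q) (k + l) # add_logs qs ks ls"
| "add_logs _ _ _ = []"

fun sub_logs :: "int list \<Rightarrow> int list \<Rightarrow> int list \<Rightarrow> int list" where
  "sub_logs (q # qs) (k # ks) (l # ls) = wrap (group_order q) (k + (group_order q - l)) # sub_logs qs ks ls"
| "sub_logs _ _ _ = []"

lemma length_add_logs [simp]:
  "length ks = length qs \<Longrightarrow> length ls = length qs \<Longrightarrow> length (add_logs qs ks ls) = length qs"
  by (induction qs ks ls rule: add_logs.induct) auto

lemma length_sub_logs [simp]:
  "length ks = length qs \<Longrightarrow> length ls = length qs \<Longrightarrow> length (sub_logs qs ks ls) = length qs"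
  by (induction qs ks ls rule: sub_logs.induct) auto

lemma nth_add_logs_cong:
  "i < length qs \<Longrightarrow> length ks = length qs \<Longrightarrow> length ls = length qs \<Longrightarrow>
     [add_logs qs ks ls ! i = ks ! i + ls ! i] (mod group_order (qs ! i))"
  by (induction qs ks ls arbitrary: i rule: add_logs.induct) (auto simp: nth_Cons split: nat.split)

lemma nth_sub_logs_cong:
  "i < length qs \<Longrightarrow> length ks = length qs \<Longrightarrow> length ls = length qs \<Longrightarrow>
     [sub_logs qs ks ls ! i = ks ! i - ls ! i] (mod group_order (qs ! i))"
proof (induction qs ks ls arbitrary: i rule: sub_logs.induct)
  case (1 q qs k ks l ls)
  have "[wrap (group_order q) (k + (group_order q - l)) = k + (group_order q - l)] (mod group_order q)"
    by simp
  also have "[k + (group_order q - l) = k - l] (mod group_order q)"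
    by (simp add: cong_iff_dvd_diff)
  finally show ?case
    using 1 by (cases i) auto
qed auto

text \<open>The list \<open>D\<close> contains the moduli that are known to divide \<open>X\<close>.\<close>

definition represents ::
    "int list \<Rightarrow> int list \<Rightarrow> int list \<Rightarrow> int \<Rightarrow> int list \<Rightarrow> int \<Rightarrow> int list \<Rightarrow> int \<Rightarrow> bool" where
  "represents D qs ks u xs v ys X \<longleftrightarrow> length ks = length qs \<and> length xs = length qs \<and> length ys = length qs \<and>
     (\<forall>i < length qs. X mod qs ! i =
        of_bool (qs ! i \<notin> set D) * antilog (qs ! i) (ks ! i + u * xs ! i + v * ys ! i))"

lemma represents_cong:
  assumes "represents D qs ks u xs v ys X"
    and "length ks' = length qs" "length xs' = length qs" "length ys' = length qs"
    and "\<And>i. i < length qs \<Longrightarrow> [ks ! i + u * xs ! i + v * ys ! i = ks' ! i + u' * xs' ! i + v' * ys' ! i]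
           (mod group_order (qs ! i))"
  shows "represents D qs ks' u' xs' v' ys' X"
  using assms antilog_cong[OF assms(5)] by (simp add: represents_def)

lemma represents_commute: "represents D qs ks u xs v ys X \<Longrightarrow> represents D qs ks v ys u xs X"
  by (simp add: represents_def algebra_simps)

lemma represents_diff_left:
  assumes "represents D qs ks u xs v ys X"
  shows "represents D qs ks u (sub_logs qs xs ys) (u + v) ys X"
proof (rule represents_cong[OF assms])
  fix i assume "i < length qs"
  then have "[u * sub_logs qs xs ys ! i = u * (xs ! i - ys ! i)] (mod group_order (qs ! i))"
    using assms by (intro cong_scalar_left nth_sub_logs_cong) (simp_all add: represents_def)
  then have "[ks ! i + u * sub_logs qs xs ys ! i + (u + v) * ys ! i =
      ks ! i + u * (xs ! i - ys ! i) + (u + v) * ys ! i] (mod group_order (qs ! i))"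
    by (intro cong_add cong_refl)
  then show "[ks ! i + u * xs ! i + v * ys ! i =
      ks ! i + u * sub_logs qs xs ys ! i + (u + v) * ys ! i] (mod group_order (qs ! i))"
    by (simp add: algebra_simps cong_sym_eq)
qed (use assms in \<open>auto simp: represents_def\<close>)

lemma represents_diff_right:
  assumes "represents D qs ks u xs v ys X"
  shows "represents D qs ks (v + u) xs v (sub_logs qs ys xs) X"
  using represents_commute[OF represents_diff_left[OF represents_commute[OF assms]]] .

section \<open>Coset trees\<close>

text \<open>
  Subtractive Euclidean algorithm on the heads; the results span the same lattice as \<open>xs\<close> and \<open>ys\<close>.
  No step merely exchanges the vectors, because the simplifier restricts the use of permutative rules.
\<close>

partial_function (option) eliminate :: "int list \<Rightarrow> int list \<Rightarrow> int list \<Rightarrow> (int list \<times> int list) option" where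
  "eliminate qs xs ys =
     (if hd ys = 0 then Some (xs, ys)
      else if hd xs = 0 then Some (ys, xs)
      else if hd xs < hd ys then eliminate qs xs (sub_logs qs ys xs)
      else eliminate qs (sub_logs qs xs ys) ys)"

lemma eliminate_represents:
  assumes "eliminate qs xs ys = Some zs" "represents D qs ks u xs v ys X"
  shows "hd (snd zs) = 0 \<and> (\<exists>u' v'. represents D qs ks u' (fst zs) v' (snd zs) X)"
  using assms
proof (induction arbitrary: u v rule: eliminate.raw_induct[rotated, consumes 1, case_names step])
  case (step elim qs xs ys zs)
  consider (right_zero) "hd ys = 0" | (left_zero) "hd ys \<noteq> 0" "hd xs = 0"
    | (less) "hd ys \<noteq> 0" "hd xs \<noteq> 0" "hd xs < hd ys" | (geq) "hd ys \<noteq> 0" "hd xs \<noteq> 0" "hd ys \<le> hd xs"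
    by linarith
  then show ?case
  proof cases
    case right_zero
    with step.hyps have "zs = (xs, ys)"
      by simp
    with step.prems right_zero show ?thesis
      by auto
  next
    case left_zero
    with step.hyps have "zs = (ys, xs)"
      by simp
    with represents_commute[OF step.prems] left_zero show ?thesis
      by force
  next
    case less
    with step.hyps show ?thesis
      by (intro step.IH[OF _ represents_diff_right[OF step.prems]]) simp
  next
    case geq
    with step.hyps show ?thesis
      by (intro step.IH[OF _ represents_diff_left[OF step.prems]]) simp
  qed
qed

partial_function (option) multiples ::
    "int list \<Rightarrow> int list \<Rightarrow> int list \<Rightarrow> int list list \<Rightarrow> (int list list \<times> int list) option" where
  "multiples qs xs ys ts =
     (if hd ys = 0 then Some (ts, ys) else multiples qs xs (add_logs qs ys xs) (ys # ts))"

definition is_multiple :: "int list \<Rightarrow> int \<Rightarrow> int list \<Rightarrow> int list \<Rightarrow> bool" where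
  "is_multiple qs r xs ys \<longleftrightarrow> length xs = length qs \<and> length ys = length qs \<and>
     (\<forall>i < length qs. [ys ! i = r * xs ! i] (mod group_order (qs ! i)))"

lemma is_multiple_1: "length xs = length qs \<Longrightarrow> is_multiple qs 1 xs xs"
  by (simp add: is_multiple_def)

lemma is_multiple_Suc:
  assumes "is_multiple qs r xs ys"
  shows "is_multiple qs (r + 1) xs (add_logs qs ys xs)"
  using assms by (auto simp: is_multiple_def distrib_right intro!: cong_trans[OF nth_add_logs_cong] cong_add)

lemma multiples_complete:
  assumes "multiples qs xs ys us = Some ws" "0 < r" "is_multiple qs r xs ys"
    and "\<And>i. 0 < i \<Longrightarrow> i < r \<Longrightarrow> \<exists>t \<in> set us. is_multiple qs i xs t"
  shows "hd (snd ws) = 0 \<and> (\<exists>r > 0. is_multiple qs r xs (snd ws) \<and>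
    (\<forall>i. 0 < i \<and> i < r \<longrightarrow> (\<exists>t \<in> set (fst ws). is_multiple qs i xs t)))"
  using assms
proof (induction arbitrary: r rule: multiples.raw_induct[rotated, consumes 1, case_names step])
  case (step mult qs xs ys us ws)
  show ?case
  proof (cases "hd ys = 0")
    case True
    with step show ?thesis
      by auto
  next
    case False
    show ?thesis
    proof (rule step.IH)
      show "mult qs xs (add_logs qs ys xs) (ys # us) = Some ws"
        using step.hyps False by simp
      show "is_multiple qs (r + 1) xs (add_logs qs ys xs)"
        using step.prems by (simp add: is_multiple_Suc)
      show "\<exists>t \<in> set (ys # us). is_multiple qs i xs t" if "0 < i" "i < r + 1" for i
        using step.prems that by (cases "i = r") auto
    qed (use step.prems in simp)
  qed
qed

text \<open>
  In a level \<open>(e, ts)\<close> for the modulus \<open>q\<close>, the vectors \<open>ts\<close> and zero represent the cosets of the next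
  lattice in the current one, and \<open>e = 0\<close> signals that \<open>q\<close> divides the term.  The zero vector is
  written \<open>[]\<close>, so that translating by it costs nothing.
\<close>

type_synonym level = "int \<times> int list list"

fun levels :: "int list \<Rightarrow> int list \<Rightarrow> int list \<Rightarrow> int list \<Rightarrow> level list option" where
  "levels D [] xs ys = Some []"
| "levels D (q # qs) xs ys =
     Option.bind (eliminate (q # qs) xs ys) (\<lambda>(xs', ys').
     Option.bind (multiples (q # qs) xs' xs' []) (\<lambda>(ts, zs).
     Option.bind (levels D qs (tl zs) (tl ys')) (\<lambda>Ls.
     Some ((if q \<in> set D then 0 else 1, ts) # Ls))))"

fun translate :: "int list \<Rightarrow> int list \<Rightarrow> int list \<Rightarrow> int list" where
  "translate qs ks [] = ks"
| "translate qs ks (l # ls) = add_logs qs ks (l # ls)"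

lemma translate_eq_add_logs:
  "length ks = length qs \<Longrightarrow> length ls = length qs \<Longrightarrow> translate qs ks ls = add_logs qs ks ls"
  by (cases ls) auto

fun translated_residues :: "int \<Rightarrow> int \<Rightarrow> int \<Rightarrow> int list list \<Rightarrow> (int \<times> int list) list" where
  "translated_residues q e k [] = []"
| "translated_residues q e k (t # ts) =
     (e * antilog q (wrap (group_order q) (k + hd t)), tl t) # translated_residues q e k ts"

fun residues :: "int \<Rightarrow> level \<Rightarrow> int \<Rightarrow> (int \<times> int list) list" where
  "residues q (e, ts) k = (e * antilog q k, []) # translated_residues q e k ts"

lemma residues_translate:
  assumes "t \<in> insert [] (set ts)" "translate (q # qs) (k # ks) t = k' # ks'"
  shows "(e * antilog q k', tl t) \<in> set (residues q (e, ts) k)"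
proof -
  have "(e * antilog q (wrap (group_order q) (k + hd t)), tl t) \<in> set (translated_residues q e k ts)"
    if "t \<in> set ts"
    using that
    by (induction ts) auto
  with assms show ?thesis
    by (cases t) auto
qed

fun admits :: "int list \<Rightarrow> level list \<Rightarrow> int list \<Rightarrow> int \<Rightarrow> bool" where
  "admits (q # qs) (L # Ls) (k # ks) X \<longleftrightarrow>
     (\<exists>ls. (X mod q, ls) \<in> set (residues q L k) \<and> admits qs Ls (translate qs ks ls) X)"
| "admits [] [] [] X \<longleftrightarrow> True"
| "admits _ _ _ X \<longleftrightarrow> False"

lemma represents_multiple:
  assumes "represents D qs ks u xs v ys X" "is_multiple qs r xs zs"
    and "ts = [] \<and> u mod r = 0 \<or> is_multiple qs (u mod r) xs ts"
  shows "represents D qs (translate qs ks ts) (u div r) zs v ys X"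
proof (rule represents_cong[OF assms(1)])
  fix i assume i: "i < length qs"
  let ?n = "group_order (qs ! i)"
  have "[translate qs ks ts ! i = ks ! i + u mod r * xs ! i] (mod ?n)"
    using assms i by (cases "ts = []")
      (auto simp: represents_def is_multiple_def translate_eq_add_logs
        intro!: cong_trans[OF nth_add_logs_cong] cong_add)
  moreover have "[u div r * zs ! i = u div r * (r * xs ! i)] (mod ?n)"
    using assms(2) i by (intro cong_scalar_left) (simp add: is_multiple_def)
  ultimately have "[translate qs ks ts ! i + u div r * zs ! i + v * ys ! i =
      ks ! i + u mod r * xs ! i + u div r * (r * xs ! i) + v * ys ! i] (mod ?n)"
    by (intro cong_add cong_refl)
  also have "ks ! i + u mod r * xs ! i + u div r * (r * xs ! i) + v * ys ! i =
      ks ! i + (u div r * r + u mod r) * xs ! i + v * ys ! i"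
    by (simp only: algebra_simps)
  finally show "[ks ! i + u * xs ! i + v * ys ! i =
      translate qs ks ts ! i + u div r * zs ! i + v * ys ! i] (mod ?n)"
    by (simp add: cong_sym_eq)
qed (use assms in \<open>auto simp: represents_def is_multiple_def translate_eq_add_logs\<close>)

lemma multiples_represents:
  assumes "multiples qs xs xs [] = Some (ts, zs)" "represents D qs ks u xs v ys X"
  obtains t u' where "hd zs = 0" "t \<in> insert [] (set ts)" "t = [] \<or> length t = length qs"
    "represents D qs (translate qs ks t) u' zs v ys X"
proof -
  have "is_multiple qs 1 xs xs"
    using assms(2) by (simp add: is_multiple_1 represents_def)
  with multiples_complete[OF assms(1), of 1] obtain r where r: "0 < r" "is_multiple qs r xs zs" "hd zs = 0"
    and cover: "\<And>i. 0 < i \<Longrightarrow> i < r \<Longrightarrow> \<exists>t \<in> set ts. is_multiple qs i xs t"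
    by auto
  have "u mod r = 0 \<or> 0 < u mod r \<and> u mod r < r"
    using pos_mod_sign[OF r(1), of u] pos_mod_bound[OF r(1), of u] by linarith
  then have "\<exists>t \<in> insert [] (set ts). t = [] \<and> u mod r = 0 \<or> is_multiple qs (u mod r) xs t"
    using cover[of "u mod r"] by auto
  then obtain t where t: "t \<in> insert [] (set ts)" "t = [] \<and> u mod r = 0 \<or> is_multiple qs (u mod r) xs t"
    by (rule bexE)
  show ?thesis
  proof (rule that[OF r(3) t(1)])
    show "represents D qs (translate qs ks t) (u div r) zs v ys X"
      using represents_multiple[OF assms(2) r(2) t(2)] .
    show "t = [] \<or> length t = length qs"
      using t(2) by (auto simp: is_multiple_def)
  qed
qed

lemma represents_Cons:
  assumes "represents D (q # qs) ks u xs v ys X" "hd xs = 0" "hd ys = 0"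
  obtains k ks' where "ks = k # ks'" "X mod q = of_bool (q \<notin> set D) * antilog q k"
    "represents D qs ks' u (tl xs) v (tl ys) X"
  using assms by (cases ks; cases xs; cases ys) (auto simp: represents_def All_less_Suc2)

lemma levels_admits:
  assumes "levels D qs xs ys = Some Ls" "represents D qs ks u xs v ys X"
  shows "admits qs Ls ks X"
  using assms
proof (induction qs arbitrary: xs ys Ls ks u v)
  case Nil
  then show ?case
    by (simp add: represents_def)
next
  case (Cons q qs)
  obtain xs' ys' ts zs Ls' where eqs: "eliminate (q # qs) xs ys = Some (xs', ys')"
      "multiples (q # qs) xs' xs' [] = Some (ts, zs)" "levels D qs (tl zs) (tl ys') = Some Ls'"
      and Ls: "Ls = (of_bool (q \<notin> set D), ts) # Ls'"
    using Cons.prems(1) by (fastforce simp: bind_eq_Some_conv)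
  obtain u' v' where "represents D (q # qs) ks u' xs' v' ys' X" and "hd ys' = 0"
    using eliminate_represents[OF eqs(1) Cons.prems(2)] by auto
  then obtain t u'' where t: "hd zs = 0" "t \<in> insert [] (set ts)" "t = [] \<or> length t = Suc (length qs)"
      "represents D (q # qs) (translate (q # qs) ks t) u'' zs v' ys' X"
    using multiples_represents[OF eqs(2)] by (metis length_Cons)
  obtain k ks' where ks: "ks = k # ks'" "length ks' = length qs"
    using Cons.prems(2) by (cases ks) (auto simp: represents_def)
  obtain l ls where ls: "translate (q # qs) ks t = l # ls" "X mod q = of_bool (q \<notin> set D) * antilog q l"
      "represents D qs ls u'' (tl zs) v' (tl ys') X"
    using represents_Cons[OF t(4,1) \<open>hd ys' = 0\<close>] .
  have "(X mod q, tl t) \<in> set (residues q (of_bool (q \<notin> set D), ts) k)"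
    using residues_translate[OF t(2) ls(1)[unfolded ks(1)]] by (simp only: ls(2))
  moreover have "translate qs ks' (tl t) = ls"
    using t(3) ls(1) ks by (cases t) (auto simp: translate_eq_add_logs)
  ultimately show ?case
    using Cons.IH[OF eqs(3) ls(3)] unfolding Ls ks(1) by auto
qed

section \<open>The sieve\<close>

fun third_matches :: "int \<Rightarrow> 'a \<Rightarrow> 'b \<Rightarrow> (int \<times> 'c) list \<Rightarrow> ('a \<times> 'b \<times> 'c) list" where
  "third_matches r a b [] = []"
| "third_matches r a b ((t, c) # zs) =
     (if r = t then (a, b, c) # third_matches r a b zs else third_matches r a b zs)"

fun second_matches :: "int \<Rightarrow> int \<Rightarrow> 'a \<Rightarrow> (int \<times> 'b) list \<Rightarrow> (int \<times> 'c) list \<Rightarrow> ('a \<times> 'b \<times> 'c) list" where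
  "second_matches q r a [] zs = []"
| "second_matches q r a ((s, b) # ys) zs = third_matches (wrap q (r + s)) a b zs @ second_matches q r a ys zs"

fun matches :: "int \<Rightarrow> (int \<times> 'a) list \<Rightarrow> (int \<times> 'b) list \<Rightarrow> (int \<times> 'c) list \<Rightarrow> ('a \<times> 'b \<times> 'c) list" where
  "matches q [] ys zs = []"
| "matches q ((r, a) # xs) ys zs = second_matches q r a ys zs @ matches q xs ys zs"

lemma in_set_matches:
  assumes "(r, a) \<in> set xs" "(s, b) \<in> set ys" "(wrap q (r + s), c) \<in> set zs"
  shows "(a, b, c) \<in> set (matches q xs ys zs)"
proof -
  have "(t, c) \<in> set zs \<Longrightarrow> (a, b, c) \<in> set (third_matches t a b zs)" for t
    by (induction zs) auto
  then have "(a, b, c) \<in> set (second_matches q r a ys zs)"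
    using assms(2,3) by (induction ys) auto
  then show ?thesis
    using assms(1) by (induction xs) auto
qed

fun increments :: "int \<Rightarrow> (int \<times> 'a) list \<Rightarrow> (int \<times> 'a) list" where
  "increments q [] = []"
| "increments q ((t, c) # zs) = (wrap q (t + 1), c) # increments q zs"

lemma in_set_increments: "(t, c) \<in> set zs \<Longrightarrow> (wrap q (t + 1), c) \<in> set (increments q zs)"
  by (induction zs) auto

type_synonym state = "int list \<times> int list \<times> int list"

fun translate_states :: "int list \<Rightarrow> state \<Rightarrow> state list \<Rightarrow> state list" where
  "translate_states qs (xs, ys, zs) [] = []"
| "translate_states qs (xs, ys, zs) ((a, b, c) # ts) =
     (translate qs xs a, translate qs ys b, translate qs zs c) # translate_states qs (xs, ys, zs) ts"

lemma in_set_translate_states: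
  "(a, b, c) \<in> set ts \<Longrightarrow>
     (translate qs xs a, translate qs ys b, translate qs zs c) \<in> set (translate_states qs (xs, ys, zs) ts)"
  by (induction ts) auto

fun successors :: "int \<Rightarrow> int list \<Rightarrow> level \<Rightarrow> level \<Rightarrow> level \<Rightarrow> state list \<Rightarrow> state list" where
  "successors q qs L M N [] = []"
| "successors q qs L M N ((xs, ys, zs) # S) =
     translate_states qs (tl xs, tl ys, tl zs)
       (matches q (residues q L (hd xs)) (residues q M (hd ys)) (increments q (residues q N (hd zs)))) @
     successors q qs L M N S"

lemma in_set_successors:
  assumes "X + Y = Z + 1" "1 < q" "(x # xs, y # ys, z # zs) \<in> set S"
    and "(X mod q, a) \<in> set (residues q L x)" "(Y mod q, b) \<in> set (residues q M y)"
    and "(Z mod q, c) \<in> set (residues q N z)"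
  shows "(translate qs xs a, translate qs ys b, translate qs zs c) \<in> set (successors q qs L M N S)"
proof -
  have "0 \<le> X mod q" "X mod q < q" "0 \<le> Y mod q" "Y mod q < q" "0 \<le> Z mod q" "Z mod q < q"
    using assms(2) by simp_all
  then have "wrap q (X mod q + Y mod q) = (X mod q + Y mod q) mod q"
    and "wrap q (Z mod q + 1) = (Z mod q + 1) mod q"
    using assms(2) by (intro wrap_eq_mod; linarith)+
  then have "wrap q (X mod q + Y mod q) = wrap q (Z mod q + 1)"
    using assms(1) by (simp add: mod_simps)
  then have "(wrap q (X mod q + Y mod q), c) \<in> set (increments q (residues q N z))"
    using in_set_increments[OF assms(6), of q] by (simp only:)
  then have "(a, b, c) \<in> set (matches q (residues q L x) (residues q M y) (increments q (residues q N z)))"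
    by (rule in_set_matches[OF assms(4,5)])
  with assms(3) show ?thesis
    by (induction S) (auto simp: in_set_translate_states)
qed

fun sieve :: "int list \<Rightarrow> level list \<Rightarrow> level list \<Rightarrow> level list \<Rightarrow> state list \<Rightarrow> state list" where
  "sieve (q # qs) (L # Ls) (M # Ms) (N # Ns) S = sieve qs Ls Ms Ns (successors q qs L M N S)"
| "sieve _ _ _ _ S = S"

lemma sieve_nonempty:
  assumes "X + Y = Z + 1" "\<forall>q \<in> set qs. 1 < q" "(xs, ys, zs) \<in> set S"
    and "admits qs Ls xs X" "admits qs Ms ys Y" "admits qs Ns zs Z"
  shows "sieve qs Ls Ms Ns S \<noteq> []"
  using assms(2-)
proof (induction qs arbitrary: Ls Ms Ns xs ys zs S)
  case Nil
  then show ?case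
    by auto
next
  case (Cons q qs)
  obtain L Ls' x xs' a where x: "Ls = L # Ls'" "xs = x # xs'" "(X mod q, a) \<in> set (residues q L x)"
      "admits qs Ls' (translate qs xs' a) X"
    using Cons.prems(3) by (cases Ls; cases xs) auto
  obtain M Ms' y ys' b where y: "Ms = M # Ms'" "ys = y # ys'" "(Y mod q, b) \<in> set (residues q M y)"
      "admits qs Ms' (translate qs ys' b) Y"
    using Cons.prems(4) by (cases Ms; cases ys) auto
  obtain N Ns' z zs' c where z: "Ns = N # Ns'" "zs = z # zs'" "(Z mod q, c) \<in> set (residues q N z)"
      "admits qs Ns' (translate qs zs' c) Z"
    using Cons.prems(5) by (cases Ns; cases zs) auto
  have "(translate qs xs' a, translate qs ys' b, translate qs zs' c) \<in> set (successors q qs L M N S)"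
    using in_set_successors[OF assms(1) _ _ x(3) y(3) z(3)] Cons.prems(1,2) x(2) y(2) z(2) by simp
  from Cons.IH[OF _ this x(4) y(4) z(4)] show ?case
    using Cons.prems(1) by (simp add: x(1) y(1) z(1))
qed

section \<open>Terms\<close>

definition log_vector :: "int list \<Rightarrow> int list \<Rightarrow> int \<Rightarrow> int list" where
  "log_vector D qs x = map (\<lambda>q. if q \<in> set D then 0 else dlog q x) qs"

definition has_logs :: "int list \<Rightarrow> int list \<Rightarrow> int \<Rightarrow> bool" where
  "has_logs D qs x \<longleftrightarrow> list_all (\<lambda>q. q \<in> set D \<or> has_dlog q x) qs"

text \<open>A coset tree describes the residues of the terms \<open>c p\<^sup>a p'\<^sup>b\<close>; an absent prime is replaced by 1.\<close>

type_synonym coset_tree = "int list \<times> level list"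

definition coset_tree :: "int list \<Rightarrow> int list \<Rightarrow> int \<Rightarrow> int \<Rightarrow> int \<Rightarrow> coset_tree option" where
  "coset_tree qs D c p p' =
     (if has_logs D qs c \<and> has_logs D qs p \<and> has_logs D qs p'
      then map_option (Pair (log_vector D qs c)) (levels D qs (log_vector D qs p) (log_vector D qs p'))
      else None)"

lemma coset_tree_admits:
  assumes "coset_tree qs D c p p' = Some (ks, Ls)" "list_all has_generator qs"
    and "list_all (\<lambda>q. q dvd c * p ^ a * p' ^ b) D"
  shows "admits qs Ls ks (c * p ^ a * p' ^ b)"
proof -
  have logs: "has_logs D qs c" "has_logs D qs p" "has_logs D qs p'" and ks: "ks = log_vector D qs c"
    and Ls: "levels D qs (log_vector D qs p) (log_vector D qs p') = Some Ls"
    using assms(1) by (auto simp: coset_tree_def split: if_splits)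
  have "c * p ^ a * p' ^ b mod q =
      of_bool (q \<notin> set D) * antilog q (dlog q c + int a * dlog q p + int b * dlog q p')"
    if "q \<in> set qs" for q
  proof (cases "q \<in> set D")
    case True
    then show ?thesis
      using assms(3) by (simp add: list_all_iff)
  next
    case False
    then have "has_generator q" "has_dlog q c" "has_dlog q p" "has_dlog q p'"
      using that assms(2) logs by (auto simp: has_logs_def list_all_iff)
    with False show ?thesis
      by (simp add: antilog_dlog_term)
  qed
  then have "represents D qs ks (int a) (log_vector D qs p) (int b) (log_vector D qs p') (c * p ^ a * p' ^ b)"
    by (simp add: represents_def ks log_vector_def)
  then show ?thesis
    using Ls by (rule levels_admits[rotated])
qed

fun refutes :: "int list \<Rightarrow> coset_tree option \<Rightarrow> coset_tree option \<Rightarrow> coset_tree option \<Rightarrow> bool" where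
  "refutes qs (Some (xs, Ls)) (Some (ys, Ms)) (Some (zs, Ns)) \<longleftrightarrow> sieve qs Ls Ms Ns [(xs, ys, zs)] = []"
| "refutes _ _ _ _ \<longleftrightarrow> False"

lemma refutes_sound:
  assumes "list_all has_generator qs"
    and "refutes qs (coset_tree qs D1 c1 p1 p2) (coset_tree qs D2 c2 p3 p4) (coset_tree qs D3 c3 p5 p6)"
    and "list_all (\<lambda>q. q dvd c1 * p1 ^ a1 * p2 ^ a2) D1"
    and "list_all (\<lambda>q. q dvd c2 * p3 ^ a3 * p4 ^ a4) D2"
    and "list_all (\<lambda>q. q dvd c3 * p5 ^ a5 * p6 ^ a6) D3"
  shows "c1 * p1 ^ a1 * p2 ^ a2 + c2 * p3 ^ a3 * p4 ^ a4 \<noteq> c3 * p5 ^ a5 * p6 ^ a6 + 1"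
proof
  assume eq: "c1 * p1 ^ a1 * p2 ^ a2 + c2 * p3 ^ a3 * p4 ^ a4 = c3 * p5 ^ a5 * p6 ^ a6 + 1"
  obtain xs Ls ys Ms zs Ns where trees: "coset_tree qs D1 c1 p1 p2 = Some (xs, Ls)"
      "coset_tree qs D2 c2 p3 p4 = Some (ys, Ms)" "coset_tree qs D3 c3 p5 p6 = Some (zs, Ns)"
    using assms(2) by (elim refutes.elims) auto
  have "sieve qs Ls Ms Ns [(xs, ys, zs)] \<noteq> []"
    using coset_tree_admits[OF trees(1) assms(1,3)] coset_tree_admits[OF trees(2) assms(1,4)]
      coset_tree_admits[OF trees(3) assms(1,5)]
    using assms(1) by (intro sieve_nonempty[OF eq]) (auto simp: list_all_iff has_generator_def)
  then show False
    using assms(2) trees by simp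
qed

section \<open>Evaluation by rewriting\<close>

text \<open>
  Since \<open>simp only\<close> normalises both branches of a conditional, recursive functions are evaluated through
  conditional rules or rules that match on patterns.
\<close>

lemma unit_groups_lookup: "list_all (\<lambda>(q, n, g). group_order q = n \<and> primitive_root q = g) unit_groups"
  by (simp add: group_order_def primitive_root_def unit_groups_def)

lemmas arith_rules = arith_simps rel_simps arith_special numeral_One diff_self zero_le_one mult_1_left mult_1_right
  mod_pos_pos_trivial mod_pos_geq wrap_def wrap_if.simps simp_thms unit_groups_lookup[unfolded unit_groups_def, simplified]

lemma tabulates_rules:
  "k < group_order q \<Longrightarrow>
     tabulates q k x \<longleftrightarrow> antilog q k = x \<and> tabulates q (k + 1) (x * primitive_root q mod q)"
  "group_order q \<le> k \<Longrightarrow> tabulates q k x \<longleftrightarrow> True"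
  by (simp_all add: tabulates.simps[of q k x])

lemma antilog_table: "list_all (\<lambda>(q, n, g). tabulates q 0 1) unit_groups"
  using unit_groups_generated
  by (auto simp: list_all_iff antilog_def has_generator_def intro!: tabulates_antilog)

lemmas antilog_rules =
  antilog_table[unfolded unit_groups_def, simplified list.pred_inject prod.case tabulates_rules arith_rules]

lemma dlog_from_rules:
  "antilog q k = x \<Longrightarrow> dlog_from q x k = k"
  "antilog q k \<noteq> x \<Longrightarrow> k < group_order q \<Longrightarrow> dlog_from q x k = dlog_from q x (k + 1)"
  "group_order q \<le> k \<Longrightarrow> dlog_from q x k = k"
  by (simp_all add: dlog_from.simps[of q x k])

lemma dlog_table:
  "list_all (\<lambda>(q, n, g). list_all (\<lambda>x. dlog q x = dlog_from q (x mod q) 0) [1, 3, 5, 7, 9, 11, 13, 17, 19])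
     unit_groups"
  by (simp add: dlog_def list_all_iff)

lemmas dlog_rules =
  dlog_table[unfolded unit_groups_def, simplified list.pred_inject prod.case dlog_from_rules antilog_rules arith_rules]

lemma eliminate_rules:
  "eliminate qs xs (0 # ys) = Some (xs, 0 # ys)"
  "y \<noteq> 0 \<Longrightarrow> eliminate qs (0 # xs) (y # ys) = Some (y # ys, 0 # xs)"
  "x \<noteq> 0 \<Longrightarrow> y \<noteq> 0 \<Longrightarrow> x < y \<Longrightarrow>
     eliminate qs (x # xs) (y # ys) = eliminate qs (x # xs) (sub_logs qs (y # ys) (x # xs))"
  "x \<noteq> 0 \<Longrightarrow> y \<noteq> 0 \<Longrightarrow> y \<le> x \<Longrightarrow>
     eliminate qs (x # xs) (y # ys) = eliminate qs (sub_logs qs (x # xs) (y # ys)) (y # ys)"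
  by (simp_all add: eliminate.simps)

lemma multiples_rules:
  "multiples qs xs (0 # ys) ts = Some (ts, 0 # ys)"
  "y \<noteq> 0 \<Longrightarrow> multiples qs xs (y # ys) ts = multiples qs xs (add_logs qs (y # ys) xs) ((y # ys) # ts)"
  by (simp_all add: multiples.simps)

lemma third_matches_rules:
  "third_matches r a b [] = []"
  "third_matches r a b ((r, c) # zs) = (a, b, c) # third_matches r a b zs"
  "r \<noteq> t \<Longrightarrow> third_matches r a b ((t, c) # zs) = third_matches r a b zs"
  by simp_all

lemmas tree_rules = coset_tree_def has_logs_def has_dlog_def log_vector_def levels.simps eliminate_rules multiples_rules
  add_logs.simps sub_logs.simps dlog_rules antilog_rules arith_rules list.map list.pred_inject list.set list.sel
  insert_iff empty_iff if_True if_False prod.case Option.bind.bind_lunit option.map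

lemmas refutation_rules = refutes.simps sieve.simps successors.simps translate_states.simps translate.simps
  increments.simps residues.simps translated_residues.simps matches.simps second_matches.simps third_matches_rules
  append.simps tree_rules

section \<open>Six odd primes with large exponents\<close>

definition moduli :: "int list" where
  "moduli = map fst unit_groups"

lemma moduli_eq: "moduli = [3, 4, 5, 7, 13, 9, 19, 37, 27, 73, 109, 81, 17, 181, 31, 25, 271, 331, 121, 67, 23]"
  by (simp add: moduli_def unit_groups_def)

definition prime_power_moduli :: "int \<Rightarrow> int list" where
  "prime_power_moduli p = filter (\<lambda>q. q dvd p ^ 6) moduli"

lemma prime_power_moduli_eq:
  "prime_power_moduli 3 = [3, 9, 27, 81]" "prime_power_moduli 5 = [5, 25]"
  "prime_power_moduli 7 = [7]" "prime_power_moduli 11 = [121]"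
  "prime_power_moduli 13 = [13]" "prime_power_moduli 17 = [17]"
  "prime_power_moduli 19 = [19]"
  by (simp_all add: prime_power_moduli_def moduli_eq)

definition high_products :: "int \<times> int \<Rightarrow> int set" where
  "high_products x = {fst x ^ a * snd x ^ b | a b. 6 \<le> a \<and> 6 \<le> b}"

lemma prime_power_moduli_dvd:
  assumes "q \<in> set (prime_power_moduli p @ prime_power_moduli p')" "6 \<le> a" "6 \<le> b"
  shows "q dvd p ^ a * p' ^ b"
proof -
  from assms(1) have "q dvd p ^ 6 \<or> q dvd p' ^ 6"
    by (auto simp: prime_power_moduli_def)
  with assms(2,3) have "q dvd p ^ a \<or> q dvd p' ^ b"
    by (meson dvd_trans le_imp_power_dvd)
  then show ?thesis
    by auto
qed

definition pair_tree :: "int \<times> int \<Rightarrow> coset_tree option" where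
  "pair_tree x = coset_tree moduli (prime_power_moduli (fst x) @ prime_power_moduli (snd x)) 1 (fst x) (snd x)"

definition excluded :: "int \<times> int \<Rightarrow> int \<times> int \<Rightarrow> int \<times> int \<Rightarrow> bool" where
  "excluded x y z \<longleftrightarrow> refutes moduli (pair_tree x) (pair_tree y) (pair_tree z)"

lemma excluded_sound:
  assumes "excluded x y z" "X \<in> high_products x" "Y \<in> high_products y" "Z \<in> high_products z"
  shows "X + Y \<noteq> Z + 1"
proof -
  obtain a1 a2 a3 a4 a5 a6 where
    X: "X = fst x ^ a1 * snd x ^ a2" "6 \<le> a1" "6 \<le> a2" and
    Y: "Y = fst y ^ a3 * snd y ^ a4" "6 \<le> a3" "6 \<le> a4" and
    Z: "Z = fst z ^ a5 * snd z ^ a6" "6 \<le> a5" "6 \<le> a6"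
    using assms(2-4) by (auto simp: high_products_def)
  have "list_all has_generator moduli"
    using unit_groups_generated by (simp add: moduli_def list_all_iff)
  from refutes_sound[OF this assms(1)[unfolded excluded_def pair_tree_def], of a1 a2 a3 a4 a5 a6] show ?thesis
    using X Y Z by (simp add: list_all_iff prime_power_moduli_dvd del: set_append)
qed

definition prime_pairs :: "(int \<times> int) list" where
  "prime_pairs = [(3, 5), (3, 7), (3, 11), (3, 13), (3, 17), (3, 19), (5, 7), (5, 11), (5, 13), (5, 17), (5, 19),
     (7, 11), (7, 13), (7, 17), (7, 19), (11, 13), (11, 17), (11, 19), (13, 17), (13, 19), (17, 19)]"

definition complementary_pairs :: "int \<times> int \<Rightarrow> ((int \<times> int) \<times> (int \<times> int)) list" where
  "complementary_pairs z = [(x, y). x \<leftarrow> prime_pairs, y \<leftarrow> prime_pairs, fst x < fst y,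
     distinct [fst x, snd x, fst y, snd y, fst z, snd z]]"

definition all_excluded :: "int \<times> int \<Rightarrow> bool" where
  "all_excluded z \<longleftrightarrow> list_all (\<lambda>(x, y). excluded x y z) (complementary_pairs z)"

lemma pair_tree_prime_pairs: "list_all (\<lambda>x. pair_tree x =
    coset_tree moduli (prime_power_moduli (fst x) @ prime_power_moduli (snd x)) 1 (fst x) (snd x)) prime_pairs"
  by (simp add: list_all_iff pair_tree_def)

lemmas pair_tree_rules = pair_tree_prime_pairs[unfolded prime_pairs_def,
  simplified prod.sel prime_power_moduli_eq append.simps moduli_eq tree_rules]

lemma all_excluded_first_prime_pairs: "list_all all_excluded (take 12 prime_pairs)"
  by (simp add: all_excluded_def complementary_pairs_def prime_pairs_def,
      simp only: excluded_def moduli_eq pair_tree_rules refutation_rules)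

lemma all_excluded_last_prime_pairs: "list_all all_excluded (drop 12 prime_pairs)"
  by (simp add: all_excluded_def complementary_pairs_def prime_pairs_def,
      simp only: excluded_def moduli_eq pair_tree_rules refutation_rules)

lemma all_excluded_prime_pairs: "list_all all_excluded prime_pairs"
  using all_excluded_first_prime_pairs all_excluded_last_prime_pairs
  by (metis append_take_drop_id list_all_append)

lemma no_solution_sorted_pairs:
  assumes "x \<in> set prime_pairs" "y \<in> set prime_pairs" "z \<in> set prime_pairs"
    and "distinct [fst x, snd x, fst y, snd y, fst z, snd z]"
    and "X \<in> high_products x" "Y \<in> high_products y" "Z \<in> high_products z"
  shows "X + Y \<noteq> Z + 1"
proof -
  have excluded: "excluded x y z" if "fst x < fst y" "x \<in> set prime_pairs" "y \<in> set prime_pairs"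
      "distinct [fst x, snd x, fst y, snd y, fst z, snd z]" for x y
  proof -
    have "(x, y) \<in> set (complementary_pairs z)"
      using that by (fastforce simp: complementary_pairs_def)
    then show ?thesis
      using all_excluded_prime_pairs assms(3) by (auto simp: list_all_iff all_excluded_def)
  qed
  show ?thesis
  proof (cases "fst x < fst y")
    case True
    then have "excluded x y z"
      using excluded assms(1,2,4) by blast
    then show ?thesis
      using excluded_sound assms(5-7) by blast
  next
    case False
    moreover have "fst x \<noteq> fst y"
      using assms(4) by simp
    ultimately have "fst y < fst x"
      by simp
    then have "excluded y x z"
      using excluded[of y x] assms(1,2,4) by auto
    then show ?thesis
      using excluded_sound assms(5-7) by (metis add.commute)
  qed
qed

definition odd_primes :: "int set" where
  "odd_primes = {3, 5, 7, 11, 13, 17, 19}"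

definition sorted_pair :: "int \<Rightarrow> int \<Rightarrow> int \<times> int" where
  "sorted_pair p p' = (min p p', max p p')"

lemma sorted_pair_in_prime_pairs:
  assumes "p \<in> odd_primes" "p' \<in> odd_primes" "p \<noteq> p'"
  shows "sorted_pair p p' \<in> set prime_pairs"
proof -
  have "\<forall>p \<in> odd_primes. \<forall>p' \<in> odd_primes. p \<noteq> p' \<longrightarrow> sorted_pair p p' \<in> set prime_pairs"
    by (simp add: odd_primes_def sorted_pair_def prime_pairs_def)
  with assms show ?thesis
    by blast
qed

lemma high_products_sorted_pair: "6 \<le> a \<Longrightarrow> 6 \<le> b \<Longrightarrow> p ^ a * p' ^ b \<in> high_products (sorted_pair p p')"
  by (cases "p \<le> p'") (auto simp: sorted_pair_def high_products_def mult.commute)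

lemma no_solution_odd_primes:
  assumes "{p1, p2, p3, p4, p5, p6} \<subseteq> odd_primes" "distinct [p1, p2, p3, p4, p5, p6]"
    and "6 \<le> a1" "6 \<le> a2" "6 \<le> a3" "6 \<le> a4" "6 \<le> a5" "6 \<le> a6"
  shows "p1 ^ a1 * p2 ^ a2 + p3 ^ a3 * p4 ^ a4 \<noteq> p5 ^ a5 * p6 ^ a6 + (1 :: int)"
proof (rule no_solution_sorted_pairs)
  show "sorted_pair p1 p2 \<in> set prime_pairs" "sorted_pair p3 p4 \<in> set prime_pairs"
      "sorted_pair p5 p6 \<in> set prime_pairs"
    using assms(1,2) by (simp_all add: sorted_pair_in_prime_pairs)
  show "distinct [fst (sorted_pair p1 p2), snd (sorted_pair p1 p2), fst (sorted_pair p3 p4), snd (sorted_pair p3 p4),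
      fst (sorted_pair p5 p6), snd (sorted_pair p5 p6)]"
    using assms(2) by (auto simp: sorted_pair_def min_def max_def)
  show "p1 ^ a1 * p2 ^ a2 \<in> high_products (sorted_pair p1 p2)"
      "p3 ^ a3 * p4 ^ a4 \<in> high_products (sorted_pair p3 p4)"
      "p5 ^ a5 * p6 ^ a6 \<in> high_products (sorted_pair p5 p6)"
    using assms(3-8) by (simp_all add: high_products_sorted_pair)
qed

lemma prime_le_19_cases:
  fixes p :: nat
  assumes "prime p" "p \<le> 19"
  shows "p = 2 \<or> int p \<in> odd_primes"
proof -
  have "\<forall>p \<in> set [2..<20]. prime p \<longrightarrow> p = 2 \<or> int p \<in> odd_primes"
    by (simp add: odd_primes_def upt_rec_numeral prime_nat_numeral_eq)
  moreover have "p \<in> set [2..<20]"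
    using assms prime_ge_2_nat[of p] by (simp del: upt_rec_numeral)
  ultimately show ?thesis
    using assms(1) by blast
qed

lemma no_prime_two:
  fixes p a :: "nat \<Rightarrow> nat"
  assumes "inj_on p {1..6}" "\<forall>i\<in>{1..6}. prime (p i) \<and> 0 < a i"
    and "p 1 ^ a 1 * p 2 ^ a 2 + p 3 ^ a 3 * p 4 ^ a 4 = p 5 ^ a 5 * p 6 ^ a 6 + 1"
  shows "\<forall>i\<in>{1..6}. p i \<noteq> 2"
proof (rule ccontr)
  assume "\<not> (\<forall>i\<in>{1..6}. p i \<noteq> 2)"
  then obtain i where i: "i \<in> {1..6}" "p i = 2"
    by blast
  have even_iff: "even (p j ^ a j) \<longleftrightarrow> i = j" if "j \<in> {1..6}" for j
  proof -
    have "even (p j) \<longleftrightarrow> p j = 2"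
      using assms(2) that by (metis dvd_refl primes_dvd_imp_eq two_is_prime_nat)
    also have "\<dots> \<longleftrightarrow> i = j"
      using assms(1) i that by (metis inj_onD)
    finally show ?thesis
      using assms(2) that by simp
  qed
  have "even (p 1 ^ a 1 * p 2 ^ a 2) \<longleftrightarrow> i = 1 \<or> i = 2" "even (p 3 ^ a 3 * p 4 ^ a 4) \<longleftrightarrow> i = 3 \<or> i = 4"
      "even (p 5 ^ a 5 * p 6 ^ a 6) \<longleftrightarrow> i = 5 \<or> i = 6"
    using even_iff[of 1] even_iff[of 2] even_iff[of 3] even_iff[of 4] even_iff[of 5] even_iff[of 6] by simp_all
  then have "(i = 1 \<or> i = 2) = (i = 3 \<or> i = 4) \<longleftrightarrow> \<not> (i = 5 \<or> i = 6)"
    using arg_cong[OF assms(3), of even] by (simp only: even_add odd_one) blast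
  moreover have "i = 1 \<or> i = 2 \<or> i = 3 \<or> i = 4 \<or> i = 5 \<or> i = 6"
    using i(1) by (simp, linarith)
  ultimately show False
    by auto
qed

lemma min_exponent_le_5:
  fixes p a :: "nat \<Rightarrow> nat"
  assumes inj: "inj_on p {1..6}" and primes: "\<forall>i\<in>{1..6}. prime (p i) \<and> p i \<le> 19"
    and eq: "int (p 1 ^ a 1 * p 2 ^ a 2) + int (p 3 ^ a 3 * p 4 ^ a 4) - int (p 5 ^ a 5 * p 6 ^ a 6) = 1"
  shows "Min (a ` {1..6}) \<le> 5"
proof (rule ccontr)
  assume "\<not> Min (a ` {1..6}) \<le> 5"
  then have a: "\<forall>i\<in>{1..6}. 6 \<le> a i"
    by (auto simp: not_le Suc_le_eq)
  have eq': "p 1 ^ a 1 * p 2 ^ a 2 + p 3 ^ a 3 * p 4 ^ a 4 = p 5 ^ a 5 * p 6 ^ a 6 + 1"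
    using eq by linarith
  have "\<forall>i\<in>{1..6}. p i \<noteq> 2"
    using primes a by (intro no_prime_two[OF inj _ eq']) (fastforce intro: order.strict_trans2[of 0 6])
  then have odd: "int (p i) \<in> odd_primes" if "i \<in> {1..6}" for i
    using that primes prime_le_19_cases by blast
  have "int (p 1) ^ a 1 * int (p 2) ^ a 2 + int (p 3) ^ a 3 * int (p 4) ^ a 4
      \<noteq> int (p 5) ^ a 5 * int (p 6) ^ a 6 + 1"
  proof (rule no_solution_odd_primes)
    show "{int (p 1), int (p 2), int (p 3), int (p 4), int (p 5), int (p 6)} \<subseteq> odd_primes"
      using odd by (intro insert_subsetI empty_subsetI) simp_all
    show "distinct [int (p 1), int (p 2), int (p 3), int (p 4), int (p 5), int (p 6)]"
      by (simp add: inj_on_eq_iff[OF inj])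
  qed (use a in simp_all)
  then show False
    using eq by simp
qed

section \<open>The equation in the primes up to 13\<close>

lemma no_solution_with_3:
  assumes "1 \<le> c"
  shows "(3::int) + 5 ^ c * 7 ^ d \<noteq> 11 ^ e * 13 ^ f + 1"
proof -
  let ?qs = "[5, 19, 37, 4, 73, 109, 181] :: int list"
  have "refutes ?qs (coset_tree ?qs [] 3 1 1) (coset_tree ?qs [5] 1 5 7) (coset_tree ?qs [] 1 11 13)"
    by (simp only: refutation_rules)
  from refutes_sound[OF _ this, of 0 0 c d e f] show ?thesis
    using assms by (simp add: has_generator_simps dvd_power)
qed

lemma no_solution_with_9_and_35:
  assumes "1 \<le> c" "1 \<le> d"
  shows "(9::int) + 5 ^ c * 7 ^ d \<noteq> 11 ^ e * 13 ^ f + 1"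
proof -
  let ?qs = "[5, 7] :: int list"
  have "refutes ?qs (coset_tree ?qs [] 9 1 1) (coset_tree ?qs [5, 7] 1 5 7) (coset_tree ?qs [] 1 11 13)"
    by (simp only: refutation_rules)
  from refutes_sound[OF _ this, of 0 0 c d e f] show ?thesis
    using assms by (simp add: has_generator_simps dvd_power)
qed

lemma no_solution_with_9_and_25:
  assumes "2 \<le> c"
  shows "(9::int) + 5 ^ c * 7 ^ d \<noteq> 11 ^ e * 13 ^ f + 1"
proof -
  let ?qs = "[5, 25, 4, 31, 181, 271, 19, 37] :: int list"
  have "refutes ?qs (coset_tree ?qs [] 9 1 1) (coset_tree ?qs [5, 25] 1 5 7) (coset_tree ?qs [] 1 11 13)"
    by (simp only: refutation_rules)
  moreover have "(25::int) dvd 5 ^ c"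
    using le_imp_power_dvd[OF assms, of "5::int"] by simp
  ultimately show ?thesis
    using refutes_sound[of ?qs "[]" 9 1 1 "[5, 25]" 1 5 7 "[]" 1 11 13 0 0 c d e f] assms
    by (simp add: has_generator_simps dvd_power)
qed

lemma no_solution_with_27:
  assumes "3 \<le> b" "1 \<le> c"
  shows "(3::int) ^ b + 5 ^ c * 7 ^ d \<noteq> 11 ^ e * 13 ^ f + 1"
proof -
  let ?qs = "[3, 4, 5, 37, 19, 27, 73, 109, 181, 31] :: int list"
  have "refutes ?qs (coset_tree ?qs [3, 27] 1 3 1) (coset_tree ?qs [5] 1 5 7) (coset_tree ?qs [] 1 11 13)"
    by (simp only: refutation_rules)
  moreover have "(27::int) dvd 3 ^ b"
    using le_imp_power_dvd[OF assms(1), of "3::int"] by simp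
  ultimately show ?thesis
    using refutes_sound[of ?qs "[3, 27]" 1 3 1 "[5]" 1 5 7 "[]" 1 11 13 b 0 c d e f] assms
    by (simp add: has_generator_simps dvd_power)
qed

lemma no_solution_without_3:
  assumes "(5::int) ^ c * 7 ^ d = 11 ^ e * 13 ^ f"
  shows "c = 0 \<and> d = 0 \<and> e = 0 \<and> f = 0"
proof -
  have coprimes: "coprime (5::int) 11" "coprime (5::int) 13" "coprime (7::int) 11" "coprime (7::int) 13"
    by (simp_all add: primes_coprime)
  have "coprime ((5::int) ^ c * 7 ^ d) (11 ^ e * 13 ^ f)"
    using coprimes by simp
  with assms have "is_unit ((5::int) ^ c * 7 ^ d)" "is_unit ((11::int) ^ e * 13 ^ f)"
    by simp_all
  then show ?thesis
    unfolding is_unit_mult_iff is_unit_power_iff by simp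
qed

lemma exponent_5_pos:
  assumes "(3::int) ^ b + 5 ^ c * 7 ^ d = 11 ^ e * 13 ^ f + 1" "0 < b"
  shows "0 < c"
proof (rule ccontr)
  assume "\<not> 0 < c"
  then have "(11::int) ^ e * 13 ^ f = 3 ^ b + (7 ^ d - 1)"
    using assms(1) by simp
  moreover have "(3::int) dvd 3 ^ b" "(3::int) dvd 7 ^ d - 1"
    using assms(2) cong_pow[of 7 1 "3::int" d] by (auto simp: cong_iff_dvd_diff)
  ultimately have "(3::int) dvd 11 ^ e * 13 ^ f"
    by simp
  then show False
    using prime_dvd_power[of "3::int" 11 e] prime_dvd_power[of "3::int" 13 f]
    by (auto simp: prime_dvd_mult_iff)
qed

lemma product_eq_13:
  assumes "(11::int) ^ e * 13 ^ f = 13"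
  shows "e = 0 \<and> f = 1"
proof -
  have "\<not> (11::int) dvd 11 ^ e * 13 ^ f"
    by (simp add: assms)
  then have "e = 0"
    by (cases e) auto
  then have "(13::int) ^ f = 13 ^ 1"
    using assms by simp
  then have "f = 1"
    by (simp only: power_inject_exp)
  with \<open>e = 0\<close> show ?thesis
    by simp
qed

lemma odd_equation_solutions:
  assumes eq: "(3::int) ^ b + 5 ^ c * 7 ^ d = 11 ^ e * 13 ^ f + 1"
  shows "(b, c, d, e, f) \<in> {(0, 0, 0, 0, 0), (2, 1, 0, 0, 1)}"
proof (cases "b = 0")
  case True
  then show ?thesis
    using no_solution_without_3[of c d e f] eq by simp
next
  case False
  then have c: "1 \<le> c"
    using exponent_5_pos[OF eq] by simp
  have "b \<noteq> 1"
    using no_solution_with_3[OF c, of d e f] eq by auto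
  moreover have "\<not> 3 \<le> b"
    using no_solution_with_27[OF _ c] eq by blast
  ultimately have b: "b = 2"
    using False by simp
  have d: "d = 0"
    using no_solution_with_9_and_35[OF c, of d e f] eq b by (cases "d = 0") auto
  have "c = 1"
    using no_solution_with_9_and_25[of c d e f] c eq b by (cases "2 \<le> c") auto
  then show ?thesis
    using product_eq_13[of e f] eq b d by simp
qed

lemma equation_solutions:
  assumes eq: "(2::int) ^ a1 * 3 ^ a2 + 5 ^ a3 * 7 ^ a4 - 11 ^ a5 * 13 ^ a6 = 1"
  shows "(a1, a2, a3, a4, a5, a6) \<in> {(0, 0, 0, 0, 0, 0), (0, 2, 1, 0, 0, 1)}"
proof -
  have "odd ((2::int) ^ a1 * 3 ^ a2 + 5 ^ a3 * 7 ^ a4 - 11 ^ a5 * 13 ^ a6)"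
    using eq by simp
  then have "a1 = 0"
    by (cases a1) auto
  then show ?thesis
    using odd_equation_solutions[of a2 a3 a4 a5 a6] eq by simp
qed

theorem theorem6:
  shows "(\<forall>p :: nat \<Rightarrow> nat. \<forall>a :: nat \<Rightarrow> nat.
            inj_on p {1..6} \<and> (\<forall>i\<in>{1..6}. prime (p i) \<and> p i \<le> 19) \<and>
            int (p 1 ^ a 1 * p 2 ^ a 2) + int (p 3 ^ a 3 * p 4 ^ a 4)
              - int (p 5 ^ a 5 * p 6 ^ a 6) = 1
            \<longrightarrow> Min (a ` {1..6}) \<le> 5)
       \<and> {(a1::nat, a2::nat, a3::nat, a4::nat, a5::nat, a6::nat).
            (2::int) ^ a1 * 3 ^ a2 + 5 ^ a3 * 7 ^ a4 - 11 ^ a5 * 13 ^ a6 = 1}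
         = {(0, 0, 0, 0, 0, 0), (0, 2, 1, 0, 0, 1)}"
    (is "?bounded \<and> ?L = ?R")
proof (rule conjI)
  show ?bounded
    using min_exponent_le_5 by blast
  show "?L = ?R"
  proof (rule equalityI)
    show "?L \<subseteq> ?R"
      using equation_solutions by fastforce
    show "?R \<subseteq> ?L"
      by auto
  qed
qed

end
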